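(* Let $R$ be an $F$-relator. The class of all $R$-simulations (1) contains all homomorphisms of $F$-coalgebras and their converses iff for every non-empty function $f$, $Ff\le Rf$ and $(Ff)^\circ\le R(f^\circ)$; (2) is closed under composition iff for all relations $r\subseteq X\times Y$ and $s\subseteq Y\times Z$ such that $s\cdot r$ is non-empty, $Rs\cdot Rr\le R(s\cdot r)$; (3) is closed under converses iff for every non-empty relation $r\subseteq X\times Y$, $R(r^\circ)=(Rr)^\circ$.
   Context: $F\colon\mathbf{Set}\to\mathbf{Set}$ is a functor. Relations $r\subseteq X\times Y$ are composed applicatively ($s\cdot r=\{(x,z)\mid\exists y.\ x\,r\,y\,s\,z\}$), ordered by inclusion, $r^\circ$ denotes the converse, and functions are regarded as relations. An $F$-relator $R$ is a monotone assignment of a relation $Rr\subseteq FX\times FY$ to each relation $r\subseteq X\times Y$. Given $F$-coalgebras $\alpha\colon X\to FX$ and $\beta\colon Y\to FY$, a relation $r\subseteq X\times Y$ is an $R$-simulation from $\alpha$ to $\beta$ if $r\le\beta^\circ\cdot Rr\cdot\alpha$, i.e. $x\,r\,y$ implies $\alpha(x)\,(Rr)\,\beta(y)$. *)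

theory Defs
  imports Main "HOL-Library.FuncSet"
begin

(* The category Set is rendered as the full category of sets on a class U of subsets of an
   arbitrary type 'u; a function X -> Y is an element of the extensional function space, and
   its graph is BNF_Def.Gr X f.  Nothing is assumed about U: it may be a Grothendieck universe,
   or all subsets of 'u.  The sets F X live in a type 'v of their own, because HOL types are
   bounded in size (for instance, the powerset of an infinite 'u does not fit into 'u).
   Endofunctors of U are the case where 'v is 'u and Fo maps U into U.
   Since F f depends on the codomain of f, the morphism part takes domain and codomain. *)

definition set_functor ::
  "'u set set \<Rightarrow> ('u set \<Rightarrow> 'v set) \<Rightarrow> ('u set \<Rightarrow> 'u set \<Rightarrow> ('u \<Rightarrow> 'u) \<Rightarrow> 'v \<Rightarrow> 'v) \<Rightarrow> bool"
  where
  "set_functor U Fo Fm \<longleftrightarrow>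
     (\<forall>X\<in>U. \<forall>Y\<in>U. \<forall>f \<in> X \<rightarrow>\<^sub>E Y. Fm X Y f \<in> Fo X \<rightarrow>\<^sub>E Fo Y) \<and>
     (\<forall>X\<in>U. Fm X X (\<lambda>x\<in>X. x) = (\<lambda>a\<in>Fo X. a)) \<and>
     (\<forall>X\<in>U. \<forall>Y\<in>U. \<forall>Z\<in>U. \<forall>f \<in> X \<rightarrow>\<^sub>E Y. \<forall>g \<in> Y \<rightarrow>\<^sub>E Z.
        Fm X Z (compose X g f) = compose (Fo X) (Fm Y Z g) (Fm X Y f))"

(* A relation from X to Y carries its source and target, so R may depend on X and Y
   and not only on the set of pairs. *)
definition relator ::
  "'u set set \<Rightarrow> ('u set \<Rightarrow> 'v set) \<Rightarrow> ('u set \<Rightarrow> 'u set \<Rightarrow> 'u rel \<Rightarrow> 'v rel) \<Rightarrow> bool"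
  where
  "relator U Fo R \<longleftrightarrow>
     (\<forall>X\<in>U. \<forall>Y\<in>U. \<forall>r. r \<subseteq> X \<times> Y \<longrightarrow> R X Y r \<subseteq> Fo X \<times> Fo Y) \<and>
     (\<forall>X\<in>U. \<forall>Y\<in>U. \<forall>r s. r \<subseteq> s \<and> s \<subseteq> X \<times> Y \<longrightarrow> R X Y r \<subseteq> R X Y s)"

type_synonym ('u, 'v) coalg = "'u set \<times> ('u \<Rightarrow> 'v)"

definition coalgebras :: "'u set set \<Rightarrow> ('u set \<Rightarrow> 'v set) \<Rightarrow> ('u, 'v) coalg set" where
  "coalgebras U Fo = {(X, \<alpha>). X \<in> U \<and> \<alpha> \<in> X \<rightarrow>\<^sub>E Fo X}"

definition homomorphisms ::
  "'u set set \<Rightarrow> ('u set \<Rightarrow> 'v set) \<Rightarrow> ('u set \<Rightarrow> 'u set \<Rightarrow> ('u \<Rightarrow> 'u) \<Rightarrow> 'v \<Rightarrow> 'v)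
     \<Rightarrow> (('u, 'v) coalg \<times> ('u, 'v) coalg \<times> ('u \<Rightarrow> 'u)) set" where
  "homomorphisms U Fo Fm =
     {((X, \<alpha>), (Y, \<beta>), f).
        (X, \<alpha>) \<in> coalgebras U Fo \<and> (Y, \<beta>) \<in> coalgebras U Fo \<and> f \<in> X \<rightarrow>\<^sub>E Y \<and>
        compose X \<beta> f = compose X (Fm X Y f) \<alpha>}"

(* The composition O is diagrammatic: r O s is the applicative s . r.  Thus the inclusion
   below says that (x, y) in r implies (\<alpha> x, \<beta> y) in R r. *)
definition simulations ::
  "'u set set \<Rightarrow> ('u set \<Rightarrow> 'v set) \<Rightarrow> ('u set \<Rightarrow> 'u set \<Rightarrow> 'u rel \<Rightarrow> 'v rel)
     \<Rightarrow> (('u, 'v) coalg \<times> ('u, 'v) coalg \<times> 'u rel) set" where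
  "simulations U Fo R =
     {((X, \<alpha>), (Y, \<beta>), r).
        (X, \<alpha>) \<in> coalgebras U Fo \<and> (Y, \<beta>) \<in> coalgebras U Fo \<and> r \<subseteq> X \<times> Y \<and>
        r \<subseteq> BNF_Def.Gr X \<alpha> O R X Y r O (BNF_Def.Gr Y \<beta>)\<inverse>}"

end

(* Constant coalgebra structures turn simulation conditions into conditions on R:
   if r is non-empty, then r is a simulation from the coalgebra on X constantly a to the
   coalgebra on Y constantly b exactly when a and b are related by R r.  So each closure
   property, applied to constant coalgebras, yields the corresponding inequality for R.
   Empty relations are always simulations, which is why they are exempt. *)

theory Submission
  imports Defs
begin

text \<open>Graphs are single-valued, so the intermediate elements of the relational composite can
  only be \<open>\<alpha> x\<close> and \<open>\<beta> y\<close>. Membership of \<open>x\<close> and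
  \<open>y\<close> in the carriers comes from \<open>r \<subseteq> X \<times> Y\<close>.\<close>

lemma simulation_iff:
  "((X, \<alpha>), (Y, \<beta>), r) \<in> simulations U Fo R \<longleftrightarrow>
     (X, \<alpha>) \<in> coalgebras U Fo \<and> (Y, \<beta>) \<in> coalgebras U Fo \<and> r \<subseteq> X \<times> Y \<and>
     (\<forall>(x, y) \<in> r. (\<alpha> x, \<beta> y) \<in> R X Y r)"
  unfolding simulations_def BNF_Def.Gr_def by fastforce

lemma const_coalgebra:
  "X \<in> U \<Longrightarrow> a \<in> Fo X \<Longrightarrow> (X, \<lambda>x\<in>X. a) \<in> coalgebras U Fo"
  by (simp add: coalgebras_def)

lemma const_simulation_iff:
  assumes "X \<in> U" "Y \<in> U" "a \<in> Fo X" "b \<in> Fo Y" "r \<subseteq> X \<times> Y"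
  shows "((X, \<lambda>x\<in>X. a), (Y, \<lambda>y\<in>Y. b), r) \<in> simulations U Fo R
           \<longleftrightarrow> r = {} \<or> (a, b) \<in> R X Y r"
proof -
  \<comment> \<open>The body on the right does not mention \<open>p\<close>; the quantifier only
    records whether \<open>r\<close> has an element.\<close>
  have "(\<forall>(x, y) \<in> r. ((\<lambda>x\<in>X. a) x, (\<lambda>y\<in>Y. b) y) \<in> R X Y r)
      \<longleftrightarrow> (\<forall>p \<in> r. (a, b) \<in> R X Y r)"
    using assms(5) by (intro ball_cong) auto
  with assms show ?thesis
    by (auto simp: simulation_iff const_coalgebra)
qed

text \<open>This is what allows related elements \<open>a\<close> and \<open>b\<close> to serve as
  the values of constant coalgebras on \<open>X\<close> and \<open>Y\<close>.\<close>

lemma relatorD: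
  "relator U Fo R \<Longrightarrow> X \<in> U \<Longrightarrow> Y \<in> U \<Longrightarrow> r \<subseteq> X \<times> Y \<Longrightarrow> (a, b) \<in> R X Y r
     \<Longrightarrow> a \<in> Fo X \<and> b \<in> Fo Y"
  unfolding relator_def by blast

lemma Gr_funcset: "f \<in> X \<rightarrow>\<^sub>E Y \<Longrightarrow> BNF_Def.Gr X f \<subseteq> X \<times> Y"
  by (auto simp: BNF_Def.Gr_def)

text \<open>With source structure constantly \<open>a\<close>, both composites in the homomorphism
  square are constant with value \<open>Fm X Y f a\<close>.\<close>

lemma const_homomorphism:
  assumes "set_functor U Fo Fm" "X \<in> U" "Y \<in> U" "f \<in> X \<rightarrow>\<^sub>E Y" "a \<in> Fo X"
  shows "Fm X Y f a \<in> Fo Y"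
    and "((X, \<lambda>x\<in>X. a), (Y, \<lambda>y\<in>Y. Fm X Y f a), f) \<in> homomorphisms U Fo Fm"
proof -
  show b: "Fm X Y f a \<in> Fo Y"
    using assms unfolding set_functor_def by (meson PiE_mem)
  show "((X, \<lambda>x\<in>X. a), (Y, \<lambda>y\<in>Y. Fm X Y f a), f) \<in> homomorphisms U Fo Fm"
    using assms b
    by (auto simp: homomorphisms_def const_coalgebra compose_def PiE_mem intro!: restrict_ext)
qed

text \<open>Left to right, each pair in the graph of \<open>Fm X Y f\<close> has the form
  \<open>(a, Fm X Y f a)\<close> and is tested by the homomorphism between constant coalgebras.
  Right to left, the homomorphism equation puts \<open>(\<alpha> x, \<beta> (f x))\<close> into that
  graph, and the assumed inclusions carry it and its converse into \<open>R\<close>.\<close>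

lemma homomorphisms_simulations_iff:
  assumes F: "set_functor U Fo Fm"
  shows
    "(\<forall>X \<alpha> Y \<beta> f. ((X, \<alpha>), (Y, \<beta>), f) \<in> homomorphisms U Fo Fm \<longrightarrow>
         ((X, \<alpha>), (Y, \<beta>), BNF_Def.Gr X f) \<in> simulations U Fo R \<and>
         ((Y, \<beta>), (X, \<alpha>), (BNF_Def.Gr X f)\<inverse>) \<in> simulations U Fo R)
      \<longleftrightarrow>
      (\<forall>X\<in>U. \<forall>Y\<in>U. \<forall>f \<in> X \<rightarrow>\<^sub>E Y. BNF_Def.Gr X f \<noteq> {} \<longrightarrow>
         BNF_Def.Gr (Fo X) (Fm X Y f) \<subseteq> R X Y (BNF_Def.Gr X f) \<and>
         (BNF_Def.Gr (Fo X) (Fm X Y f))\<inverse> \<subseteq> R Y X ((BNF_Def.Gr X f)\<inverse>))"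
    (is "?sim \<longleftrightarrow> ?rel")
proof
  assume sim: ?sim
  show ?rel
  proof (intro ballI impI)
    fix X Y f
    assume X: "X \<in> U" and Y: "Y \<in> U" and f: "f \<in> X \<rightarrow>\<^sub>E Y" and ne: "BNF_Def.Gr X f \<noteq> {}"
    have G: "BNF_Def.Gr X f \<subseteq> X \<times> Y" "(BNF_Def.Gr X f)\<inverse> \<subseteq> Y \<times> X"
      using Gr_funcset[OF f] by auto
    have "(a, Fm X Y f a) \<in> R X Y (BNF_Def.Gr X f) \<and>
          (Fm X Y f a, a) \<in> R Y X ((BNF_Def.Gr X f)\<inverse>)" if a: "a \<in> Fo X" for a
    proof -
      note hom = const_homomorphism[OF F X Y f a]
      from sim hom(2) have
        "((X, \<lambda>x\<in>X. a), (Y, \<lambda>y\<in>Y. Fm X Y f a), BNF_Def.Gr X f) \<in> simulations U Fo R"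
        "((Y, \<lambda>y\<in>Y. Fm X Y f a), (X, \<lambda>x\<in>X. a), (BNF_Def.Gr X f)\<inverse>) \<in> simulations U Fo R"
        by blast+
      \<comment> \<open>Non-emptiness of the graph, and hence of its converse, rules out the
        degenerate case of \<open>const_simulation_iff\<close>.\<close>
      with ne show ?thesis
        by (auto simp: const_simulation_iff X Y a hom(1) G)
    qed
    then show "BNF_Def.Gr (Fo X) (Fm X Y f) \<subseteq> R X Y (BNF_Def.Gr X f) \<and>
        (BNF_Def.Gr (Fo X) (Fm X Y f))\<inverse> \<subseteq> R Y X ((BNF_Def.Gr X f)\<inverse>)"
      by (auto simp: BNF_Def.Gr_def)
  qed
next
  assume rel: ?rel
  show ?sim
  proof (intro allI impI)
    fix X \<alpha> Y \<beta> f
    assume "((X, \<alpha>), (Y, \<beta>), f) \<in> homomorphisms U Fo Fm"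
    then have coalg: "(X, \<alpha>) \<in> coalgebras U Fo" "(Y, \<beta>) \<in> coalgebras U Fo"
      and f: "f \<in> X \<rightarrow>\<^sub>E Y" and eq: "compose X \<beta> f = compose X (Fm X Y f) \<alpha>"
      by (auto simp: homomorphisms_def)
    have XY: "X \<in> U" "Y \<in> U" and \<alpha>: "\<And>x. x \<in> X \<Longrightarrow> \<alpha> x \<in> Fo X"
      using coalg by (auto simp: coalgebras_def)
    have "(\<alpha> x, \<beta> (f x)) \<in> R X Y (BNF_Def.Gr X f) \<and>
          (\<beta> (f x), \<alpha> x) \<in> R Y X ((BNF_Def.Gr X f)\<inverse>)" if x: "x \<in> X" for x
    proof -
      have "\<beta> (f x) = Fm X Y f (\<alpha> x)"
        using fun_cong[OF eq, of x] x by (simp add: compose_def)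
      then have "(\<alpha> x, \<beta> (f x)) \<in> BNF_Def.Gr (Fo X) (Fm X Y f)"
        using \<alpha>[OF x] by (simp add: BNF_Def.Gr_def)
      \<comment> \<open>The point \<open>x\<close> at hand witnesses the side condition of
        \<open>?rel\<close>, so an empty carrier needs no separate treatment.\<close>
      moreover have "BNF_Def.Gr X f \<noteq> {}"
        using x by (auto simp: BNF_Def.Gr_def)
      ultimately show ?thesis
        using rel XY f by blast
    qed
    then show "((X, \<alpha>), (Y, \<beta>), BNF_Def.Gr X f) \<in> simulations U Fo R \<and>
        ((Y, \<beta>), (X, \<alpha>), (BNF_Def.Gr X f)\<inverse>) \<in> simulations U Fo R"
      using coalg Gr_funcset[OF f] by (auto simp: simulation_iff BNF_Def.Gr_def)
  qed
qed

text \<open>Left to right, the element \<open>b\<close> linking \<open>a\<close> to \<open>c\<close>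
  becomes a constant structure on \<open>Y\<close>, which makes the two simulations composable.
  Right to left, a point \<open>y\<close> linking \<open>x\<close> to \<open>z\<close> both shows
  that \<open>r O s\<close> is non-empty and gives the link \<open>\<beta> y\<close> between
  \<open>\<alpha> x\<close> and \<open>\<gamma> z\<close>.\<close>

lemma simulations_relcomp_iff:
  assumes R: "relator U Fo R"
  shows
    "(\<forall>A B C r s. (A, B, r) \<in> simulations U Fo R \<and> (B, C, s) \<in> simulations U Fo R \<longrightarrow>
         (A, C, r O s) \<in> simulations U Fo R)
      \<longleftrightarrow>
      (\<forall>X\<in>U. \<forall>Y\<in>U. \<forall>Z\<in>U. \<forall>r s. r \<subseteq> X \<times> Y \<and> s \<subseteq> Y \<times> Z \<and> r O s \<noteq> {} \<longrightarrow>
         R X Y r O R Y Z s \<subseteq> R X Z (r O s))"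
    (is "?sim \<longleftrightarrow> ?rel")
proof
  assume sim: ?sim
  show ?rel
  proof (intro ballI allI impI subrelI, elim conjE relcompEpair)
    fix X Y Z r s a c b
    assume U: "X \<in> U" "Y \<in> U" "Z \<in> U"
      and rs: "r \<subseteq> X \<times> Y" "s \<subseteq> Y \<times> Z" and ne: "r O s \<noteq> {}"
      and ab: "(a, b) \<in> R X Y r" and bc: "(b, c) \<in> R Y Z s"
    have abc: "a \<in> Fo X" "b \<in> Fo Y" "c \<in> Fo Z"
      using relatorD[OF R _ _ rs(1) ab] relatorD[OF R _ _ rs(2) bc] U by auto
    have "((X, \<lambda>x\<in>X. a), (Y, \<lambda>y\<in>Y. b), r) \<in> simulations U Fo R"
      "((Y, \<lambda>y\<in>Y. b), (Z, \<lambda>z\<in>Z. c), s) \<in> simulations U Fo R"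
      using ab bc by (simp_all add: const_simulation_iff U abc rs)
    with sim have "((X, \<lambda>x\<in>X. a), (Z, \<lambda>z\<in>Z. c), r O s) \<in> simulations U Fo R"
      by blast
    moreover have "r O s \<subseteq> X \<times> Z"
      using rs by blast
    \<comment> \<open>Here non-emptiness of the composite is essential: \<open>r\<close> and
      \<open>s\<close> may both be non-empty while \<open>r O s\<close> is empty and imposes no
      condition on \<open>a\<close> and \<open>c\<close>.\<close>
    ultimately show "(a, c) \<in> R X Z (r O s)"
      using ne by (simp add: const_simulation_iff U abc)
  qed
next
  assume rel: ?rel
  have "((X, \<alpha>), (Z, \<gamma>), r O s) \<in> simulations U Fo R"
    if r: "((X, \<alpha>), (Y, \<beta>), r) \<in> simulations U Fo R"
      and s: "((Y, \<beta>), (Z, \<gamma>), s) \<in> simulations U Fo R" for X \<alpha> Y \<beta> Z \<gamma> r s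
  proof -
    have U: "X \<in> U" "Y \<in> U" "Z \<in> U" and rs: "r \<subseteq> X \<times> Y" "s \<subseteq> Y \<times> Z"
      using r s by (auto simp: simulation_iff coalgebras_def)
    have "(\<alpha> x, \<gamma> z) \<in> R X Z (r O s)" if xy: "(x, y) \<in> r" and yz: "(y, z) \<in> s" for x y z
    proof -
      have "(\<alpha> x, \<gamma> z) \<in> R X Y r O R Y Z s"
        using r s xy yz by (auto simp: simulation_iff)
      moreover have "r O s \<noteq> {}"
        using xy yz by blast
      ultimately show ?thesis
        using rel U rs by blast
    qed
    then show ?thesis
      using r s by (auto simp: simulation_iff)
  qed
  then show ?sim
    by auto
qed

text \<open>Constant coalgebras yield only one inclusion; the other follows because taking converses
  is an involution.\<close>

lemma simulations_converse_iff:
  assumes R: "relator U Fo R"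
  shows
    "(\<forall>A B r. (A, B, r) \<in> simulations U Fo R \<longrightarrow> (B, A, r\<inverse>) \<in> simulations U Fo R)
      \<longleftrightarrow>
      (\<forall>X\<in>U. \<forall>Y\<in>U. \<forall>r. r \<subseteq> X \<times> Y \<and> r \<noteq> {} \<longrightarrow> R Y X (r\<inverse>) = (R X Y r)\<inverse>)"
    (is "?sim \<longleftrightarrow> ?rel")
proof
  assume sim: ?sim
  have conv: "(R X Y r)\<inverse> \<subseteq> R Y X (r\<inverse>)"
    if U: "X \<in> U" "Y \<in> U" and r: "r \<subseteq> X \<times> Y" and ne: "r \<noteq> {}" for X Y r
  proof (rule subrelI, unfold converse_iff)
    fix b a
    assume ab: "(a, b) \<in> R X Y r"
    note mem = relatorD[OF R U r ab]
    have "((X, \<lambda>x\<in>X. a), (Y, \<lambda>y\<in>Y. b), r) \<in> simulations U Fo R"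
      using ab by (simp add: const_simulation_iff U mem r)
    with sim have "((Y, \<lambda>y\<in>Y. b), (X, \<lambda>x\<in>X. a), r\<inverse>) \<in> simulations U Fo R"
      by blast
    moreover have "r\<inverse> \<subseteq> Y \<times> X"
      using r by blast
    ultimately show "(b, a) \<in> R Y X (r\<inverse>)"
      using ne by (auto simp: const_simulation_iff U mem)
  qed
  show ?rel
  proof (intro ballI allI impI, elim conjE)
    fix X Y r
    assume U: "X \<in> U" "Y \<in> U" and r: "r \<subseteq> X \<times> Y" and ne: "r \<noteq> {}"
    \<comment> \<open>The inclusion \<open>conv\<close> is used for \<open>r\<inverse>\<close> with
      the roles of \<open>X\<close> and \<open>Y\<close> exchanged, and the double converse
      cancels.\<close>
    have "(R Y X (r\<inverse>))\<inverse> \<subseteq> R X Y r"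
      using conv[OF U(2,1), of "r\<inverse>"] r ne by auto
    with conv[OF U r ne] show "R Y X (r\<inverse>) = (R X Y r)\<inverse>"
      by auto
  qed
next
  assume rel: ?rel
  have "((Y, \<beta>), (X, \<alpha>), r\<inverse>) \<in> simulations U Fo R"
    if r: "((X, \<alpha>), (Y, \<beta>), r) \<in> simulations U Fo R" for X \<alpha> Y \<beta> r
  \<comment> \<open>The assumption says nothing about the empty relation, but that relation is its
    own converse and a simulation between any two coalgebras.\<close>
  proof (cases "r = {}")
    case True
    with r show ?thesis
      by (simp add: simulation_iff)
  next
    case False
    with r rel have "R Y X (r\<inverse>) = (R X Y r)\<inverse>"
      by (simp add: simulation_iff coalgebras_def)
    with r show ?thesis
      by (auto simp: simulation_iff)
  qed
  then show ?sim
    by auto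
qed

theorem theorem3:
  fixes U :: "'u set set"
    and Fo :: "'u set \<Rightarrow> 'v set"
    and Fm :: "'u set \<Rightarrow> 'u set \<Rightarrow> ('u \<Rightarrow> 'u) \<Rightarrow> 'v \<Rightarrow> 'v"
    and R :: "'u set \<Rightarrow> 'u set \<Rightarrow> 'u rel \<Rightarrow> 'v rel"
  assumes "set_functor U Fo Fm"
    and "relator U Fo R"
  shows
    "((\<forall>X \<alpha> Y \<beta> f. ((X, \<alpha>), (Y, \<beta>), f) \<in> homomorphisms U Fo Fm \<longrightarrow>
         ((X, \<alpha>), (Y, \<beta>), BNF_Def.Gr X f) \<in> simulations U Fo R \<and>
         ((Y, \<beta>), (X, \<alpha>), (BNF_Def.Gr X f)\<inverse>) \<in> simulations U Fo R)
      \<longleftrightarrow>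
      (\<forall>X\<in>U. \<forall>Y\<in>U. \<forall>f \<in> X \<rightarrow>\<^sub>E Y. BNF_Def.Gr X f \<noteq> {} \<longrightarrow>
         BNF_Def.Gr (Fo X) (Fm X Y f) \<subseteq> R X Y (BNF_Def.Gr X f) \<and>
         (BNF_Def.Gr (Fo X) (Fm X Y f))\<inverse> \<subseteq> R Y X ((BNF_Def.Gr X f)\<inverse>)))
     \<and>
     ((\<forall>A B C r s. (A, B, r) \<in> simulations U Fo R \<and> (B, C, s) \<in> simulations U Fo R \<longrightarrow>
         (A, C, r O s) \<in> simulations U Fo R)
      \<longleftrightarrow>
      (\<forall>X\<in>U. \<forall>Y\<in>U. \<forall>Z\<in>U. \<forall>r s. r \<subseteq> X \<times> Y \<and> s \<subseteq> Y \<times> Z \<and> r O s \<noteq> {} \<longrightarrow>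
         R X Y r O R Y Z s \<subseteq> R X Z (r O s)))
     \<and>
     ((\<forall>A B r. (A, B, r) \<in> simulations U Fo R \<longrightarrow> (B, A, r\<inverse>) \<in> simulations U Fo R)
      \<longleftrightarrow>
      (\<forall>X\<in>U. \<forall>Y\<in>U. \<forall>r. r \<subseteq> X \<times> Y \<and> r \<noteq> {} \<longrightarrow> R Y X (r\<inverse>) = (R X Y r)\<inverse>))"
  using homomorphisms_simulations_iff[OF assms(1)] simulations_relcomp_iff[OF assms(2)]
    simulations_converse_iff[OF assms(2)]
  by (intro conjI)

end
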